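(* Let $q$ be a power of $2$ and write $N=q+1=p_1^{e_1}\cdots p_s^{e_s}$, where $p_1,\dots,p_s$ are pairwise distinct odd primes and $e_1,\dots,e_s$ are positive integers. Define $$E_q(B,C)=\operatorname{Fr}^{-1}\Big(\operatorname{lcm}\big(\mathcal U_{\frac{N}{p_1}},\dots,\mathcal U_{\frac{N}{p_s}}\big)\Big).$$ Let $f(X)=X^2+bX+c\in\mathbb F_q[X]$ be irreducible, where $c$ is a primitive element of $\mathbb F_q$. Then $f(X)$ is primitive if and only if $E_q(b,c)\neq 0$.
   Context: A primitive element of $\mathbb F_q$ is a generator of $\mathbb F_q^*$. A monic quadratic polynomial over $\mathbb F_q$ is primitive if it is the minimal polynomial over $\mathbb F_q$ of a generator of $\mathbb F_{q^2}^*$. Let $B,C$ be algebraically independent indeterminates over $\mathbb F_q$. The Lucas polynomials of the first type are $\mathcal U_0=0$, $\mathcal U_1=1$, $\mathcal U_n=-B\,\mathcal U_{n-1}-C\,\mathcal U_{n-2}$ for $n\ge2$. The lcm is the least common multiple in $\mathbb F_q[B,C]$, normalized to be monic in $B$; in the present situation ($q$ even, all indices odd) it lies in $\mathbb F_q[B^2,C]$. Inverse-Frobenius operator: let $\Phi_{q-1}$ be the $(q-1)$-st cyclotomic polynomial over $\mathbb F_q$ and $A=\mathbb F_q[C]/(\Phi_{q-1}(C))$. On $A$ one has $a^q=a$, so $a\mapsto a^2$ is an automorphism with inverse $a\mapsto a^{q/2}$. Define $\operatorname{Fr}^{-1}:A[B^2]\to A[B]$ by $\operatorname{Fr}^{-1}(\sum_i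 a_iB^{2i})=\sum_i a_i^{q/2}B^i$; for $F=\sum_{i,j}a_{ij}B^{2i}C^j\in\mathbb F_q[B^2,C]$, this means applying it to the image of $F$ in $A[B^2]$, so that $\operatorname{Fr}^{-1}(F)=\sum_{i,j}a_{ij}^{q/2}B^iC^{jq/2}$ modulo $\Phi_{q-1}(C)$. Since the roots of $\Phi_{q-1}(C)$ are exactly the primitive elements of $\mathbb F_q$, elements of $A[B]=\mathbb F_q[B,C]/(\Phi_{q-1}(C))$ have well-defined values at $(b,c)$ for $b\in\mathbb F_q$ and $c$ primitive. *)

theory Defs
  imports
    "HOL-Library.Cardinality"
    "HOL-Computational_Algebra.Computational_Algebra"
    "HOL-Algebra.Algebraic_Closure_Type"
begin

text \<open>Throughout, \<open>'a poly poly\<close> is the ring of polynomials in \<open>B\<close> and \<open>C\<close>, read as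
  polynomials in the outer variable \<open>B\<close> whose coefficients are polynomials in \<open>C\<close>.\<close>

abbreviation varB :: "'a::comm_ring_1 poly poly" where
  "varB \<equiv> [:0, 1:]"

abbreviation varC :: "'a::comm_ring_1 poly poly" where
  "varC \<equiv> [:[:0, 1:]:]"

definition eval2 :: "'a::comm_ring_1 poly poly \<Rightarrow> 'a \<Rightarrow> 'a \<Rightarrow> 'a" where
  "eval2 F b c = poly (poly F [:b:]) c"

fun lucasU :: "nat \<Rightarrow> 'a::comm_ring_1 poly poly" where
  "lucasU 0 = 0"
| "lucasU (Suc 0) = 1"
| "lucasU (Suc (Suc n)) = - varB * lucasU (Suc n) - varC * lucasU n"

text \<open>The least common multiple normalized to be monic in the outer variable. It is
  characterized by divisibility because the library instances of \<open>lcm\<close> on polynomials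
  do not cover coefficients in an arbitrary type of class \<open>field\<close>.\<close>

definition monic_lcm :: "'a::idom poly set \<Rightarrow> 'a poly" where
  "monic_lcm S = (THE L. lead_coeff L = 1 \<and> (\<forall>f\<in>S. f dvd L) \<and>
                         (\<forall>M. (\<forall>f\<in>S. f dvd M) \<longrightarrow> L dvd M))"

text \<open>The cyclotomic polynomials over a field, from
  \<open>X\<^sup>n - 1 = (\<Prod>d | d dvd n. cyclotomic d)\<close>. That identity holds over the integers, so the
  division is exact in every characteristic.\<close>

function cyclotomic :: "nat \<Rightarrow> 'a::field poly" where
  "cyclotomic n = (monom 1 n - 1) div (\<Prod>d\<in>{d. d dvd n \<and> d < n}. cyclotomic d)"
  by auto
termination by (relation "measure id") auto

declare cyclotomic.simps [simp del]

text \<open>The inverse-Frobenius operator. An element of \<open>A = F\<^sub>q[C]/(\<Phi>\<^bsub>q-1\<^esub>)\<close> is represented by its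
  remainder modulo \<open>\<Phi>\<^bsub>q-1\<^esub>\<close>. The operator is meant for polynomials in \<open>B\<^sup>2\<close>; on others the
  odd-degree coefficients are ignored.\<close>

definition inv_frob :: "'a::{finite,field} poly poly \<Rightarrow> 'a poly poly" where
  "inv_frob F = (\<Sum>i\<le>degree F.
     monom (coeff F (2 * i) ^ (CARD('a) div 2) mod cyclotomic (CARD('a) - 1)) i)"

definition generates_mult_group :: "'a::field set \<Rightarrow> 'a \<Rightarrow> bool" where
  "generates_mult_group K g \<longleftrightarrow> range (\<lambda>n::int. g powi n) = K - {0}"

definition primitive_element :: "'a::{finite,field} \<Rightarrow> bool" where
  "primitive_element g \<longleftrightarrow> generates_mult_group UNIV g"

text \<open>The subfield with \<open>q\<^sup>2\<close> elements of the algebraic closure of the field with \<open>q\<close> elements.\<close>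

definition quadratic_extension :: "'a::{finite,field} alg_closure set" where
  "quadratic_extension = {x. x ^ (CARD('a)\<^sup>2) = x}"

definition is_minimal_poly :: "'a::field poly \<Rightarrow> 'a alg_closure \<Rightarrow> bool" where
  "is_minimal_poly f \<alpha> \<longleftrightarrow>
     lead_coeff f = 1 \<and> poly (map_poly to_ac f) \<alpha> = 0 \<and>
     (\<forall>g. g \<noteq> 0 \<and> poly (map_poly to_ac g) \<alpha> = 0 \<longrightarrow> degree f \<le> degree g)"

definition primitive_quadratic :: "'a::{finite,field} poly \<Rightarrow> bool" where
  "primitive_quadratic f \<longleftrightarrow>
     lead_coeff f = 1 \<and> degree f = 2 \<and>
     (\<exists>\<alpha>. generates_mult_group quadratic_extension \<alpha> \<and> is_minimal_poly f \<alpha>)"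

end

theory Submission
  imports Defs "Berlekamp_Zassenhaus.Unique_Factorization_Poly" "HOL-Number_Theory.Residues"
begin

text \<open>Let \<open>L\<close> be the least common multiple of the Lucas polynomials. Since \<open>L\<close> is a polynomial in
  \<open>B\<^sup>2\<close> and squaring is additive in characteristic \<open>2\<close>, one has \<open>E(b, c)\<^sup>2 = L(b, c)\<close>, and \<open>L(b, c)\<close>
  vanishes iff one of the \<open>\<U>\<^bsub>N/p\<^esub>(b, c)\<close> does. If \<open>\<alpha>\<close> and \<open>\<beta> = \<alpha>\<^sup>q\<close> are the roots of \<open>f\<close>, then
  \<open>\<U>\<^sub>n(b, c) (\<alpha> - \<beta>) = \<alpha>\<^sup>n - \<beta>\<^sup>n\<close>, so \<open>\<U>\<^sub>n(b, c) = 0\<close> iff \<open>\<alpha>\<close> to the power \<open>(q - 1) n\<close> is \<open>1\<close>.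
  For \<open>n = N/p\<close> these are the conditions at the primes dividing \<open>q + 1\<close> in the criterion for \<open>\<alpha>\<close> to
  have order \<open>(q - 1) (q + 1)\<close>; the conditions at the primes dividing \<open>q - 1\<close> hold because
  \<open>\<alpha> \<beta> = c\<close> has order \<open>q - 1\<close>.\<close>

declare pCons_one [simp del]

section \<open>Monic least common multiples and Lucas polynomials\<close>

text \<open>Elements are added one at a time: if \<open>L\<close> is an lcm of the elements so far
  and \<open>h\<close> a gcd of \<open>f\<close> and \<open>L\<close>, then
  \<open>(f / h) * L\<close> is an lcm of all of them. Divisibility of the product by
  \<open>L\<close> is recorded because it later traces a zero of the lcm back to a zero of some
  member.\<close>

lemma ufd_lcm_exists:
  fixes S :: "'r::ufd set"
  assumes "finite S" and "0 \<notin> S"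
  shows "\<exists>L. L dvd \<Prod>S \<and> (\<forall>f\<in>S. f dvd L) \<and> (\<forall>M. (\<forall>f\<in>S. f dvd M) \<longrightarrow> L dvd M)"
  using assms
proof (induction S rule: finite_induct)
  case empty
  show ?case by (intro exI[of _ 1]) auto
next
  case (insert f S)
  from insert.IH insert.prems obtain L where L: "L dvd \<Prod>S" "\<forall>f\<in>S. f dvd L"
    and least: "\<And>M. (\<forall>f\<in>S. f dvd M) \<Longrightarrow> L dvd M"
    by auto
  obtain h where h: "h dvd f" "h dvd L" 
    and mult: "\<And>x d. x dvd f * d \<Longrightarrow> x dvd L * d \<Longrightarrow> x dvd h * d"
    using some_gcd.gcd_dvd1 some_gcd.gcd_dvd2 some_gcd.gcd_greatest_mult by metis
  from h obtain f' L' where f': "f = h * f'" and L': "L = h * L'"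
    by (auto simp: dvd_def)
  have "h \<noteq> 0" using insert.prems f' by auto
  show ?case
  proof (intro exI[of _ "f' * L"] conjI allI impI ballI)
    show "f' * L dvd \<Prod>(insert f S)"
      using insert.hyps L(1) f' by (auto intro: mult_dvd_mono)
    show "g dvd f' * L" if "g \<in> insert f S" for g
    proof (cases "g = f")
      case True
      have "f' * L = f * L'" by (simp add: f' L')
      with True show ?thesis by simp
    next
      case False
      with that L show ?thesis by auto
    qed
    fix M assume M: "\<forall>g\<in>insert f S. g dvd M"
    hence "f dvd M" "L dvd M" using least by auto
    \<comment> \<open>The gcd distributes over multiplication by \<open>M\<close>: a common divisor
      of \<open>f * M\<close> and \<open>L * M\<close> divides \<open>h * M\<close>. Cancelling
      \<open>h\<close> from both sides then gives minimality.\<close>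
    hence "f * L dvd L * M" "f * L dvd f * M" by (auto simp: mult.commute[of f] intro: mult_dvd_mono)
    hence "f * L dvd h * M" using mult by blast
    hence "h * (f' * L) dvd h * M" by (simp add: f' mult_ac)
    thus "f' * L dvd M" using \<open>h \<noteq> 0\<close> by simp
  qed
qed

text \<open>An lcm divides the product, whose leading coefficient is a unit. Its own leading
  coefficient is therefore a unit, and scaling by the inverse makes it monic.\<close>

lemma ufd_poly_monic_lcm_exists:
  fixes S :: "'r::ufd poly set"
  assumes "finite S" and unit: "\<And>f. f \<in> S \<Longrightarrow> lead_coeff f dvd 1"
  obtains L where "lead_coeff L = 1" "L dvd \<Prod>S" "\<forall>f\<in>S. f dvd L"
    "\<And>M. (\<forall>f\<in>S. f dvd M) \<Longrightarrow> L dvd M"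
proof -
  have nz: "0 \<notin> S" using unit by fastforce
  obtain L where L: "L dvd \<Prod>S" "\<forall>f\<in>S. f dvd L" "\<And>M. (\<forall>f\<in>S. f dvd M) \<Longrightarrow> L dvd M"
    using ufd_lcm_exists[OF assms(1) nz] by blast
  have "(\<Prod>f\<in>S. lead_coeff f) dvd (\<Prod>f\<in>S. 1)"
    by (rule prod_dvd_prod) (use unit in auto)
  hence "lead_coeff (\<Prod>S) dvd 1" by (simp add: lead_coeff_prod)
  moreover have "lead_coeff L dvd lead_coeff (\<Prod>S)"
    using L(1) by (auto simp: dvd_def lead_coeff_mult)
  ultimately have "lead_coeff L dvd 1" by (rule dvd_trans[rotated])
  then obtain u where u: "lead_coeff L * u = 1" by (metis dvdE)
  hence "u dvd 1" by (metis dvd_triv_right)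
  have eq: "L = smult (lead_coeff L) (smult u L)" using u by simp
  have LL: "smult u L dvd L" by (subst (2) eq) (rule dvd_smult, rule dvd_refl)
  show thesis
  proof (rule that[of "smult u L"])
    show "lead_coeff (smult u L) = 1" using u by (auto simp: mult.commute)
    show "smult u L dvd \<Prod>S" using LL L(1) by (rule dvd_trans)
    show "\<forall>f\<in>S. f dvd smult u L" using L(2) by (auto intro: dvd_smult)
    show "smult u L dvd M" if "\<forall>f\<in>S. f dvd M" for M
      using LL L(3)[OF that] by (rule dvd_trans)
  qed
qed

text \<open>Two candidates divide each other, so they differ by a unit of the polynomial ring. Such
  a unit is a constant, and monicity forces it to be 1.\<close>

lemma monic_lcm_eqI:
  fixes S :: "'r::idom poly set"
  assumes "lead_coeff L = 1" "\<forall>f\<in>S. f dvd L" "\<And>M. (\<forall>f\<in>S. f dvd M) \<Longrightarrow> L dvd M"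
  shows "monic_lcm S = L"
  unfolding monic_lcm_def
proof (rule the_equality)
  show "lead_coeff L = 1 \<and> (\<forall>f\<in>S. f dvd L) \<and> (\<forall>M. (\<forall>f\<in>S. f dvd M) \<longrightarrow> L dvd M)"
    using assms by blast
  fix K assume K: "lead_coeff K = 1 \<and> (\<forall>f\<in>S. f dvd K) \<and> (\<forall>M. (\<forall>f\<in>S. f dvd M) \<longrightarrow> K dvd M)"
  hence "K dvd L" "L dvd K" using assms by auto
  then obtain x y where x: "L = K * x" and y: "K = L * y" by (metis dvdE)
  have "L \<noteq> 0" using assms(1) by auto
  have "L * 1 = L * (y * x)" using x y by (metis mult.assoc mult.right_neutral)
  hence "y * x = 1" using \<open>L \<noteq> 0\<close> by (metis mult_cancel_left)
  hence "y dvd 1" by (metis dvd_triv_left)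
  then obtain d where "y = [:d:]" by (metis is_unit_polyE)
  moreover have "lead_coeff y = 1" using y K assms(1) by (metis lead_coeff_mult mult_1)
  ultimately show "K = L" using y by (simp add: one_pCons[symmetric])
qed

section \<open>Polynomials in the square of the variable, written as compositions with
  \<open>[:0, 0, 1:]\<close>\<close>

lemma coeff_pcompose_square:
  fixes p :: "'r::comm_ring_1 poly"
  shows "coeff (p \<circ>\<^sub>p [:0, 0, 1:]) n = (if even n then coeff p (n div 2) else 0)"
proof (induction p arbitrary: n)
  case (pCons a p)
  consider "n = 0" | "n = 1" | m where "n = Suc (Suc m)" by (metis One_nat_def not0_implies_Suc)
  thus ?case
    by cases (auto simp: pcompose_pCons pCons.IH coeff_pCons split: nat.splits)
qed simp

lemma poly_even_odd_decomposition:
  fixes M :: "'r::comm_ring_1 poly"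
  obtains M0 M1 where "M = M0 \<circ>\<^sub>p [:0, 0, 1:] + [:0, 1:] * (M1 \<circ>\<^sub>p [:0, 0, 1:])"
proof (induction M arbitrary: thesis)
  case 0
  show ?case by (rule 0[of 0 0]) simp
next
  case (pCons a M)
  obtain M0 M1 where M: "M = M0 \<circ>\<^sub>p [:0, 0, 1:] + [:0, 1:] * (M1 \<circ>\<^sub>p [:0, 0, 1:])"
    using pCons.IH by blast
  show ?case
    \<comment> \<open>Multiplying \<open>M\<close> by the variable exchanges its even and odd parts:
      the old odd part, shifted by one power of the square and with \<open>a\<close> added, becomes
      the even part.\<close>
    by (rule pCons.prems[of "pCons a M1" M0])
       (subst M, simp add: pcompose_pCons algebra_simps)
qed

lemma poly_even_odd_unique:
  fixes P Q :: "'r::comm_ring_1 poly"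
  assumes "P \<circ>\<^sub>p [:0, 0, 1:] + [:0, 1:] * (Q \<circ>\<^sub>p [:0, 0, 1:]) =
    P' \<circ>\<^sub>p [:0, 0, 1:] + [:0, 1:] * (Q' \<circ>\<^sub>p [:0, 0, 1:])"
  shows "P = P'" and "Q = Q'"
proof -
  have eq: "coeff (P \<circ>\<^sub>p [:0, 0, 1:] + [:0, 1:] * (Q \<circ>\<^sub>p [:0, 0, 1:])) n =
     coeff (P' \<circ>\<^sub>p [:0, 0, 1:] + [:0, 1:] * (Q' \<circ>\<^sub>p [:0, 0, 1:])) n" for n
    using assms by simp
  show "P = P'"
  proof (rule poly_eqI)
    show "coeff P n = coeff P' n" for n
      using eq[of "2 * n"]
      by (cases n) (auto simp: coeff_pcompose_square coeff_pCons poly_0_coeff_0 split: nat.splits)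
  qed
  show "Q = Q'"
  proof (rule poly_eqI)
    show "coeff Q n = coeff Q' n" for n
      using eq[of "Suc (2 * n)"] by (auto simp: coeff_pcompose_square coeff_pCons split: nat.splits)
  qed
qed

text \<open>The ring \<open>R[B]\<close> is free over \<open>R[B\<^sup>2]\<close> with basis \<open>1, B\<close>, so divisibility by an element of
  \<open>R[B\<^sup>2]\<close> can be tested on the two components.\<close>

lemma pcompose_square_dvd_iff:
  fixes u :: "'r::comm_ring_1 poly"
  shows "u \<circ>\<^sub>p [:0, 0, 1:] dvd M0 \<circ>\<^sub>p [:0, 0, 1:] + [:0, 1:] * (M1 \<circ>\<^sub>p [:0, 0, 1:]) \<longleftrightarrow>
    u dvd M0 \<and> u dvd M1"
    (is "?u dvd ?M \<longleftrightarrow> _")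
proof
  assume "?u dvd ?M"
  then obtain K where K: "?M = ?u * K" by (auto simp: dvd_def)
  obtain K0 K1 where "K = K0 \<circ>\<^sub>p [:0, 0, 1:] + [:0, 1:] * (K1 \<circ>\<^sub>p [:0, 0, 1:])"
    by (rule poly_even_odd_decomposition)
  hence "?M = (u * K0) \<circ>\<^sub>p [:0, 0, 1:] + [:0, 1:] * ((u * K1) \<circ>\<^sub>p [:0, 0, 1:])"
    using K by (simp only: pcompose_mult algebra_simps)
  hence "M0 = u * K0" "M1 = u * K1" by (rule poly_even_odd_unique)+
  thus "u dvd M0 \<and> u dvd M1" by simp
next
  assume "u dvd M0 \<and> u dvd M1"
  then obtain K0 K1 where K: "M0 = u * K0" "M1 = u * K1" by (auto simp: dvd_def)
  have "?M = ?u * (K0 \<circ>\<^sub>p [:0, 0, 1:] + [:0, 1:] * (K1 \<circ>\<^sub>p [:0, 0, 1:]))"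
    unfolding K by (simp only: pcompose_mult algebra_simps)
  thus "?u dvd ?M" by (metis dvd_triv_left)
qed

text \<open>The lcm \<open>L\<close> is formed first, with the variable standing for its own future
  square, and the square is substituted afterwards. Minimality must hold against every common
  multiple \<open>M\<close>, including those with odd powers; it is checked on the even and odd
  parts of \<open>M\<close> separately.\<close>

lemma monic_lcm_pcompose_square:
  fixes S :: "'r::ufd poly set"
  assumes "finite S" and "\<And>f. f \<in> S \<Longrightarrow> lead_coeff f dvd 1"
  obtains L where "monic_lcm ((\<lambda>f. f \<circ>\<^sub>p [:0, 0, 1:]) ` S) = L \<circ>\<^sub>p [:0, 0, 1:]"
    and "\<forall>f\<in>S. f dvd L" and "L dvd \<Prod>S"
proof -
  obtain L where L: "lead_coeff L = 1" "L dvd \<Prod>S" "\<forall>f\<in>S. f dvd L"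
    "\<And>M. (\<forall>f\<in>S. f dvd M) \<Longrightarrow> L dvd M"
    using ufd_poly_monic_lcm_exists[OF assms] by blast
  have "monic_lcm ((\<lambda>f. f \<circ>\<^sub>p [:0, 0, 1:]) ` S) = L \<circ>\<^sub>p [:0, 0, 1:]"
  proof (rule monic_lcm_eqI)
    have "degree (L \<circ>\<^sub>p [:0, 0, 1:]) = 2 * degree L"
      by (simp add: degree_pcompose)
    thus "lead_coeff (L \<circ>\<^sub>p [:0, 0, 1:]) = 1"
      using L(1) by (simp add: coeff_pcompose_square)
    show "\<forall>g\<in>(\<lambda>f. f \<circ>\<^sub>p [:0, 0, 1:]) ` S. g dvd L \<circ>\<^sub>p [:0, 0, 1:]"
      using L(3) by (auto simp: dvd_def pcompose_mult)
    fix M assume M: "\<forall>g\<in>(\<lambda>f. f \<circ>\<^sub>p [:0, 0, 1:]) ` S. g dvd M"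
    obtain M0 M1 where M01: "M = M0 \<circ>\<^sub>p [:0, 0, 1:] + [:0, 1:] * (M1 \<circ>\<^sub>p [:0, 0, 1:])"
      by (rule poly_even_odd_decomposition)
    have "\<forall>f\<in>S. f dvd M0 \<and> f dvd M1"
      using M unfolding M01 by (simp only: ball_simps pcompose_square_dvd_iff)
    hence "L dvd M0 \<and> L dvd M1" using L(4) by blast
    thus "L \<circ>\<^sub>p [:0, 0, 1:] dvd M" unfolding M01 pcompose_square_dvd_iff .
  qed
  thus thesis using that L by blast
qed

text \<open>The two parities are proved together because the recurrence for each index uses one
  predecessor of either parity.\<close>

lemma lucasU_even_odd:
  "\<exists>u v. (lucasU (Suc (2 * n)) :: 'r::comm_ring_1 poly poly) = u \<circ>\<^sub>p [:0, 0, 1:] \<and>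
         (lucasU (2 * n) :: 'r poly poly) = varB * (v \<circ>\<^sub>p [:0, 0, 1:])"
proof (induction n)
  case 0
  show ?case by (intro exI[of _ 1] exI[of _ 0]) (simp add: pcompose_1)
next
  case (Suc n)
  then obtain u v where uv: "(lucasU (Suc (2 * n)) :: 'r poly poly) = u \<circ>\<^sub>p [:0, 0, 1:]"
    "(lucasU (2 * n) :: 'r poly poly) = varB * (v \<circ>\<^sub>p [:0, 0, 1:])" by blast
  \<comment> \<open>Read off from -B u(B^2) - C B v(B^2) = B (-u - C v)(B^2), the recurrence at the
    next even index.\<close>
  define w where "w = - u - varC * v"
  have rec: "(lucasU (2 * Suc n) :: 'r poly poly) =
      - varB * lucasU (Suc (2 * n)) - varC * lucasU (2 * n)"
    "(lucasU (Suc (2 * Suc n)) :: 'r poly poly) =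
      - varB * lucasU (2 * Suc n) - varC * lucasU (Suc (2 * n))"
    by (simp_all only: mult_Suc_right add_2_eq_Suc lucasU.simps)
  have C: "varC \<circ>\<^sub>p [:0, 0, 1:] = (varC :: 'r poly poly)" by (simp add: pcompose_pCons)
  have B: "varB \<circ>\<^sub>p [:0, 0, 1:] = varB * (varB :: 'r poly poly)" by (simp add: pcompose_pCons)
  have w: "(lucasU (2 * Suc n) :: 'r poly poly) = varB * (w \<circ>\<^sub>p [:0, 0, 1:])"
    unfolding w_def pcompose_diff pcompose_uminus pcompose_mult C
    unfolding rec(1) uv
    by (simp only: mult_minus_left mult_minus_right algebra_simps)
  have "(lucasU (Suc (2 * Suc n)) :: 'r poly poly) = (- varB * w - varC * u) \<circ>\<^sub>p [:0, 0, 1:]"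
    unfolding pcompose_diff pcompose_uminus pcompose_mult B C rec(2) uv w
    by (simp only: pcompose_mult pcompose_uminus B mult_minus_left mult_minus_right algebra_simps)
  with w show ?case by blast
qed

text \<open>The degree bound is carried along in the induction so that the term with C, whose degree
  is two lower, contributes nothing to the top coefficient.\<close>

lemma lucasU_degree_coeff:
  "degree (lucasU (Suc n) :: 'r::comm_ring_1 poly poly) \<le> n \<and>
   coeff (lucasU (Suc n) :: 'r poly poly) n = (- 1) ^ n"
proof (induction n rule: less_induct)
  case (less n)
  consider "n = 0" | "n = 1" | m where "n = Suc (Suc m)" by (metis One_nat_def not0_implies_Suc)
  thus ?case
  proof cases
    case (3 m)
    have IH: "degree (lucasU (Suc (Suc m)) :: 'r poly poly) \<le> Suc m"
      "coeff (lucasU (Suc (Suc m)) :: 'r poly poly) (Suc m) = (- 1) ^ Suc m"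
      "degree (lucasU (Suc m) :: 'r poly poly) \<le> m"
      using less[of "Suc m"] less[of m] 3 by auto
    show ?thesis
      unfolding 3 lucasU.simps(3)[of "Suc m"]
      using IH by (auto simp: coeff_eq_0 simp del: lucasU.simps
        intro!: degree_diff_le degree_pCons_le[THEN order.trans] degree_smult_le[THEN order.trans])
  qed auto
qed

lemma lead_coeff_lucasU:
  "lead_coeff (lucasU (Suc n) :: 'r::idom poly poly) = (- 1) ^ n"
proof -
  have "coeff (lucasU (Suc n) :: 'r poly poly) n \<noteq> 0"
    using lucasU_degree_coeff[where 'r = 'r, of n] by simp
  hence "degree (lucasU (Suc n) :: 'r poly poly) = n"
    using lucasU_degree_coeff[where 'r = 'r, of n] le_degree by (metis antisym)
  thus ?thesis using lucasU_degree_coeff[where 'r = 'r, of n] by simp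
qed

lemma odd_lucasU_pcompose_square:
  assumes "odd n"
  obtains u where "(lucasU n :: 'r::idom poly poly) = u \<circ>\<^sub>p [:0, 0, 1:]" and "lead_coeff u dvd 1"
proof -
  obtain m where m: "n = Suc (2 * m)" using assms by (metis oddE Suc_eq_plus1)
  then obtain u where u: "(lucasU n :: 'r poly poly) = u \<circ>\<^sub>p [:0, 0, 1:]"
    using lucasU_even_odd[where 'r = 'r, of m] by blast
  have "degree (u \<circ>\<^sub>p [:0, 0, 1:]) = 2 * degree u" by (simp add: degree_pcompose)
  hence "lead_coeff (u \<circ>\<^sub>p [:0, 0, 1:]) = lead_coeff u" by (simp add: coeff_pcompose_square)
  hence "lead_coeff u = 1" using u m lead_coeff_lucasU[where 'r = 'r, of "2 * m"] by simp
  thus thesis using that u by simp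
qed

section \<open>Evaluation at a point as a ring homomorphism\<close>

lemma eval2_simps [simp]:
  fixes F G :: "'r::comm_ring_1 poly poly"
  shows "eval2 (F + G) x y = eval2 F x y + eval2 G x y"
    and "eval2 (F - G) x y = eval2 F x y - eval2 G x y"
    and "eval2 (F * G) x y = eval2 F x y * eval2 G x y"
    and "eval2 (- F) x y = - eval2 F x y"
    and "eval2 0 x y = 0" and "eval2 1 x y = 1"
    and "eval2 varB x y = x" and "eval2 varC x y = y"
  by (simp_all add: eval2_def)

lemma eval2_prod: "eval2 (\<Prod>i\<in>A. F i) x y = (\<Prod>i\<in>A. eval2 (F i) x y)"
  by (induction A rule: infinite_finite_induct) auto

lemma eval2_pcompose_square: "eval2 (F \<circ>\<^sub>p [:0, 0, 1:]) x y = eval2 F (x\<^sup>2) y"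
  by (simp add: eval2_def poly_pcompose power2_eq_square)

section \<open>Orders of elements and cyclotomic polynomials\<close>

text \<open>For \<open>m > 0\<close> this is the exact multiplicative order. The value
  \<open>m = 0\<close> describes elements none of whose positive powers is 1, including 0.\<close>

definition has_order :: "'a::field \<Rightarrow> nat \<Rightarrow> bool" where
  "has_order g m \<longleftrightarrow> (\<forall>j. g ^ j = 1 \<longleftrightarrow> m dvd j)"

lemma has_order_unique: "has_order g m \<Longrightarrow> has_order g n \<Longrightarrow> m = n"
  unfolding has_order_def by (metis dvd_antisym dvd_refl)

lemma has_order_exists:
  assumes "g ^ n = 1" and "n > 0"
  obtains m where "has_order g m" and "m dvd n" and "m > 0"
proof -
  define m where "m = (LEAST m. g ^ m = 1 \<and> m > 0)"
  have m: "g ^ m = 1 \<and> m > 0"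
    unfolding m_def by (rule LeastI[of _ n]) (use assms in auto)
  have least: "j = 0" if "g ^ j = 1" "j < m" for j
    using not_less_Least[of j "\<lambda>m. g ^ m = 1 \<and> m > 0"] that by (auto simp: m_def)
  have "m dvd j" if "g ^ j = 1" for j
  proof -
    have "g ^ j = (g ^ m) ^ (j div m) * g ^ (j mod m)"
      by (simp flip: power_mult power_add)
    hence "g ^ (j mod m) = 1" using that m by simp
    hence "j mod m = 0" using least m by simp
    thus ?thesis by auto
  qed
  hence "has_order g m" using m by (auto simp: has_order_def power_mult)
  moreover from this have "m dvd n" using assms by (simp add: has_order_def)
  ultimately show thesis using that m by blast
qed

text \<open>The order \<open>m\<close> divides \<open>n\<close>. If the cofactor \<open>k\<close>
  were not 1, a prime \<open>p\<close> dividing it would leave \<open>n div p\<close> a multiple of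
  \<open>m\<close>, against the hypothesis at \<open>p\<close>.\<close>

lemma has_orderI_prime:
  assumes "g ^ n = 1" and "n > 0" and "\<And>p. prime p \<Longrightarrow> p dvd n \<Longrightarrow> g ^ (n div p) \<noteq> 1"
  shows "has_order g n"
proof -
  obtain m where m: "has_order g m" "m dvd n"
    using has_order_exists[OF assms(1,2)] by blast
  then obtain k where k: "n = m * k" by (auto simp: dvd_def)
  have "k = 1"
  proof (rule ccontr)
    assume "k \<noteq> 1"
    then obtain p where p: "prime p" "p dvd k" using prime_factor_nat by blast
    then obtain l where "k = p * l" by (auto simp: dvd_def)
    hence "n div p = m * l" using k p by simp
    hence "g ^ (n div p) = 1" using m by (simp add: has_order_def)
    moreover have "p dvd n" using p k by simp
    ultimately show False using assms(3) p by blast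
  qed
  thus ?thesis using m k by simp
qed

lemma has_order_nonzero: "has_order g m \<Longrightarrow> m > 0 \<Longrightarrow> g \<noteq> 0"
  unfolding has_order_def by (metis dvd_refl power_0_left zero_neq_one less_irrefl)

lemma has_order_powers_inj:
  assumes "has_order g m" and "m > 0"
  shows "inj_on (\<lambda>i. g ^ i) {..<m}"
proof (rule linorder_inj_onI)
  fix i j assume ij: "i < j" "i \<in> {..<m}" "j \<in> {..<m}"
  have "g ^ j = g ^ i * g ^ (j - i)" using ij by (simp flip: power_add)
  moreover have "g ^ (j - i) \<noteq> 1" using assms(1) ij by (auto simp: has_order_def dest: dvd_imp_le)
  ultimately show "g ^ i \<noteq> g ^ j" using has_order_nonzero[OF assms] by simp
qed auto

text \<open>An integer exponent may be reduced modulo \<open>m\<close>, so negative powers add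
  nothing to the first \<open>m\<close> natural powers.\<close>

lemma has_order_range_powi:
  assumes "has_order g m" and "m > 0"
  shows "range (\<lambda>n::int. g powi n) = (\<lambda>i. g ^ i) ` {..<m}"
proof (intro equalityI subsetI)
  note nz = has_order_nonzero[OF assms]
  have one: "g ^ m = 1" using assms(1) by (simp add: has_order_def)
  fix x assume "x \<in> range (\<lambda>n::int. g powi n)"
  then obtain n where "x = g powi n" by blast
  also have "g powi n = g powi (int m * (n div int m) + n mod int m)" by simp
  also have "\<dots> = (g ^ m) powi (n div int m) * g powi (n mod int m)"
    using nz by (simp only: power_int_add power_int_power simp_thms)
  also have "\<dots> = g ^ nat (n mod int m)"
    using assms(2) by (simp add: one power_int_nonneg_exp)
  finally have "x = g ^ nat (n mod int m)" .
  moreover have "nat (n mod int m) < m" using assms(2) by (simp add: nat_less_iff)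
  ultimately show "x \<in> (\<lambda>i. g ^ i) ` {..<m}" by blast
next
  fix x assume "x \<in> (\<lambda>i. g ^ i) ` {..<m}"
  then obtain i where "x = g ^ i" by blast
  hence "x = g powi int i" by simp
  thus "x \<in> range (\<lambda>n::int. g powi n)" by blast
qed

lemma has_order_card_range_powi:
  assumes "has_order g m" and "m > 0"
  shows "card (range (\<lambda>n::int. g powi n)) = m"
  unfolding has_order_range_powi[OF assms]
  using card_image[OF has_order_powers_inj[OF assms]] by simp

text \<open>An element of order \<open>m\<close> has exactly \<open>m\<close> distinct powers, so
  generating is a matter of counting. In the forward direction finiteness of \<open>K\<close> forces
  two natural powers of \<open>g\<close> to coincide, which provides a finite order.\<close>

lemma generates_mult_group_iff:
  fixes K :: "'a::field set"
  assumes "finite K" and "K - {0} \<noteq> {}" and "range (\<lambda>n::int. g powi n) \<subseteq> K - {0}"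
  shows "generates_mult_group K g \<longleftrightarrow> has_order g (card (K - {0}))"
proof
  assume "has_order g (card (K - {0}))"
  moreover have "card (K - {0}) > 0" using assms(1,2) by (simp add: card_gt_0_iff)
  ultimately have "card (range (\<lambda>n::int. g powi n)) = card (K - {0})"
    by (rule has_order_card_range_powi)
  thus "generates_mult_group K g"
    unfolding generates_mult_group_def using assms by (intro card_subset_eq) auto
next
  assume gen: "generates_mult_group K g"
  have "g = g powi 1" by simp
  hence "g \<in> K - {0}" using assms(3) by blast
  have "\<not> inj (\<lambda>n::nat. g ^ n)"
  proof
    assume "inj (\<lambda>n::nat. g ^ n)"
    hence "infinite (range (\<lambda>n::nat. g ^ n))" using finite_imageD by blast
    moreover have "range (\<lambda>n::nat. g ^ n) \<subseteq> K"
    proof clarify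
      fix n :: nat
      have "g ^ n = g powi int n" by simp
      thus "g ^ n \<in> K" using assms(3) by blast
    qed
    ultimately show False using assms(1) finite_subset by blast
  qed
  then obtain i j :: nat where ij: "i < j" "g ^ i = g ^ j"
    by (metis injI linorder_neqE_nat)
  have "g ^ j = g ^ i * g ^ (j - i)" using ij(1) by (simp flip: power_add)
  with ij have "g ^ (j - i) = 1" "j - i > 0" using \<open>g \<in> K - {0}\<close> by auto
  then obtain m where m: "has_order g m" "m > 0" using has_order_exists by blast
  have "card (K - {0}) = m"
    using has_order_card_range_powi[OF m] gen by (simp add: generates_mult_group_def)
  thus "has_order g (card (K - {0}))" using m by simp
qed

lemma primitive_element_iff_has_order:
  fixes c :: "'a::{finite,field}"
  assumes "c \<noteq> 0"
  shows "primitive_element c \<longleftrightarrow> has_order c (CARD('a) - 1)"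
proof -
  have "card (UNIV - {0::'a}) = CARD('a) - 1" by (simp add: card_Diff_singleton)
  moreover have "UNIV - {0} \<noteq> ({} :: 'a set)" using assms by auto
  moreover have "range (\<lambda>n::int. c powi n) \<subseteq> UNIV - {0}" using assms by auto
  ultimately show ?thesis
    unfolding primitive_element_def using generates_mult_group_iff[of "UNIV :: 'a set" c] by simp
qed

section \<open>Roots of unity and cyclotomic polynomials\<close>

lemma degree_X_pow_minus_1:
  assumes "n > 0"
  shows "degree (monom 1 n - 1 :: 'a::field poly) = n"
proof -
  have "degree (monom 1 n + (- 1) :: 'a poly) = degree (monom 1 n :: 'a poly)"
    by (rule degree_add_eq_left) (use assms in \<open>simp add: degree_monom_eq\<close>)
  thus ?thesis by (simp add: degree_monom_eq)
qed

lemma finite_roots_of_unity: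
  assumes "n > 0"
  shows "finite {x::'a::field. x ^ n = 1}"
proof -
  have "(monom 1 n - 1 :: 'a poly) \<noteq> 0" using degree_X_pow_minus_1[OF assms, where 'a = 'a] assms by auto
  hence "finite {x. poly (monom 1 n - 1 :: 'a poly) x = 0}" by (rule poly_roots_finite)
  thus ?thesis by (simp add: poly_monom)
qed

text \<open>The power of \<open>c\<close> with exponent \<open>m / n\<close> has order
  \<open>n\<close>, so its powers supply \<open>n\<close> distinct zeros of a polynomial of degree
  \<open>n\<close>.\<close>

lemma X_pow_minus_1_splits:
  fixes c :: "'a::field"
  assumes "has_order c m" and "m > 0" and "n dvd m"
  shows "monom 1 n - 1 = (\<Prod>x\<in>{x::'a. x ^ n = 1}. [:- x, 1:])"
proof -
  obtain k where k: "m = n * k" using assms by (auto simp: dvd_def)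
  hence pos: "n > 0" "k > 0" using assms by auto
  have fin: "finite {x::'a. x ^ n = 1}" by (rule finite_roots_of_unity[OF pos(1)])
  have "has_order (c ^ k) n"
    unfolding has_order_def using assms(1) k pos
    by (simp add: has_order_def flip: power_mult)
  hence "card ((\<lambda>i. (c ^ k) ^ i) ` {..<n}) = n"
    using card_image[OF has_order_powers_inj] pos by fastforce
  moreover have "(\<lambda>i. (c ^ k) ^ i) ` {..<n} \<subseteq> {x. x ^ n = 1}"
    using \<open>has_order (c ^ k) n\<close> unfolding has_order_def by (auto simp flip: power_mult simp: mult.assoc)
  ultimately have ge: "n \<le> card {x::'a. x ^ n = 1}" using card_mono[OF fin] by metis
  have "(monom 1 n - 1 :: 'a poly) \<noteq> 0" using degree_X_pow_minus_1[OF pos(1), where 'a = 'a] pos by auto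
  hence "card {x::'a. x ^ n = 1} \<le> n"
    using card_poly_roots_bound[of "monom 1 n - 1 :: 'a poly"] degree_X_pow_minus_1[OF pos(1), where 'a = 'a]
    by (simp add: poly_monom)
  with ge have card: "card {x::'a. x ^ n = 1} = n" by simp
  have deg: "degree (\<Prod>x\<in>{x::'a. x ^ n = 1}. [:- x, 1:]) = n"
    by (subst degree_prod_eq_sum_degree) (auto simp: card)
  moreover have "lead_coeff (\<Prod>x\<in>{x::'a. x ^ n = 1}. [:- x, 1:]) = 1"
    by (simp add: lead_coeff_prod)
  ultimately have coeff: "coeff (\<Prod>x\<in>{x::'a. x ^ n = 1}. [:- x, 1:]) n = 1" by simp
  show ?thesis
  \<comment> \<open>Both sides have degree \<open>n\<close> and top coefficient 1, so their
    difference has degree below \<open>n\<close>; it also vanishes at all \<open>n\<close> roots of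
    unity.\<close>
  proof (rule poly_eqI_degree_lead_coeff[of _ n _ "{x. x ^ n = 1}"])
    show "coeff (monom 1 n - 1) n = coeff (\<Prod>x\<in>{x::'a. x ^ n = 1}. [:- x, 1:]) n"
      using coeff pos by simp
    show "poly (monom 1 n - 1) z = poly (\<Prod>x\<in>{x. x ^ n = 1}. [:- x, 1:]) z"
      if "z \<in> {x. x ^ n = 1}" for z :: 'a
    proof -
      have "poly (\<Prod>x\<in>{x. x ^ n = 1}. [:- x, 1:]) z = 0"
        using that fin by (auto simp: poly_prod intro!: prod_zero bexI[of _ z])
      thus ?thesis using that by (simp add: poly_monom)
    qed
  qed (use ge deg degree_X_pow_minus_1[OF pos(1), where 'a = 'a] in auto)
qed

text \<open>Grouping the zeros of X^n - 1 by their order writes it as a product over the divisors of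
  \<open>n\<close>. By induction the factors at proper divisors are cyclotomic polynomials, and the
  division in the definition of \<open>cyclotomic\<close> leaves the factor at
  \<open>n\<close>.\<close>

lemma cyclotomic_eq_prod:
  fixes c :: "'a::field"
  assumes "has_order c m" and "m > 0" and "n dvd m"
  shows "cyclotomic n = (\<Prod>x\<in>{x::'a. has_order x n}. [:- x, 1:])"
  using assms(3)
proof (induction n rule: less_induct)
  case (less n)
  have pos: "n > 0" using less.prems assms(2) by (auto intro: Nat.gr0I)
  define P where "P = (\<lambda>d. \<Prod>x\<in>{x::'a. has_order x d}. [:- x, 1:])"
  have sub: "{x::'a. has_order x d} \<subseteq> {x. x ^ n = 1}" if "d dvd n" for d
    using that by (auto simp: has_order_def)
  have fin: "finite {x::'a. has_order x d}" if "d dvd n" for d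
    using finite_subset[OF sub[OF that] finite_roots_of_unity[OF pos]] .
  have roots: "{x::'a. x ^ n = 1} = (\<Union>d\<in>{d. d dvd n}. {x. has_order x d})"
    using sub by (auto elim: has_order_exists[OF _ pos])
  have "monom 1 n - 1 = (\<Prod>x\<in>{x::'a. x ^ n = 1}. [:- x, 1:])"
    by (rule X_pow_minus_1_splits[OF assms(1,2) less.prems])
  also have "\<dots> = (\<Prod>x\<in>(\<Union>d\<in>{d. d dvd n}. {x::'a. has_order x d}). [:- x, 1:])"
    by (simp only: roots)
  also have "\<dots> = (\<Prod>d\<in>{d. d dvd n}. P d)"
    unfolding P_def using pos fin by (intro prod.UNION_disjoint) (auto dest: has_order_unique)
  also have "{d. d dvd n} = insert n {d. d dvd n \<and> d < n}" using pos by (auto dest: dvd_imp_le)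
  also have "(\<Prod>d\<in>insert n {d. d dvd n \<and> d < n}. P d) = P n * (\<Prod>d\<in>{d. d dvd n \<and> d < n}. P d)"
    by (rule prod.insert) auto
  also have "(\<Prod>d\<in>{d. d dvd n \<and> d < n}. P d) = (\<Prod>d\<in>{d. d dvd n \<and> d < n}. cyclotomic d)"
  proof (rule prod.cong[OF refl])
    fix d assume "d \<in> {d. d dvd n \<and> d < n}"
    hence "d < n" "d dvd m" using less.prems by (auto intro: dvd_trans)
    thus "P d = cyclotomic d" unfolding P_def by (rule less.IH[symmetric])
  qed
  finally have eq: "monom 1 n - 1 = P n * (\<Prod>d\<in>{d. d dvd n \<and> d < n}. cyclotomic d)" .
  hence "(\<Prod>d\<in>{d. d dvd n \<and> d < n}. cyclotomic d) \<noteq> (0 :: 'a poly)"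
    using degree_X_pow_minus_1[OF pos, where 'a = 'a] pos by (metis degree_0 less_irrefl mult_zero_right)
  thus ?case
    unfolding cyclotomic.simps[of n] eq P_def by simp
qed

text \<open>This makes values at a primitive \<open>c\<close> independent of the representative
  modulo the cyclotomic polynomial.\<close>

lemma poly_cyclotomic_root:
  fixes c :: "'a::field"
  assumes "has_order c m" and "m > 0"
  shows "poly (cyclotomic m) c = 0"
proof -
  have "x ^ m = 1" if "has_order x m" for x :: 'a
    using that by (simp add: has_order_def)
  hence "{x::'a. has_order x m} \<subseteq> {x. x ^ m = 1}" by blast
  hence "finite {x::'a. has_order x m}" using finite_roots_of_unity[OF assms(2)] by (rule finite_subset)
  hence "(\<Prod>x\<in>{x::'a. has_order x m}. poly [:- x, 1:] c) = 0"
    by (rule prod_zero) (use assms(1) in auto)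
  thus ?thesis
    by (simp only: cyclotomic_eq_prod[OF assms dvd_refl] poly_prod)
qed

section \<open>The inverse-Frobenius operator\<close>

lemma primitive_element_nonzero:
  assumes "primitive_element c"
  shows "c \<noteq> 0"
proof -
  have "c = c powi 1" by simp
  also have "\<dots> \<in> UNIV - {0}"
    using assms unfolding primitive_element_def generates_mult_group_def by blast
  finally show ?thesis by simp
qed

lemma CARD_field_ge_2: "CARD('a::{finite,field}) \<ge> 2"
proof -
  have "card {0, 1::'a} \<le> CARD('a)" by (rule card_mono) auto
  thus ?thesis by simp
qed

text \<open>A nonzero \<open>x\<close> is a power of \<open>c\<close>, so its power with exponent q
  - 1 is a power of c^(q-1) = 1.\<close>

lemma primitive_element_imp_power_card:
  fixes c x :: "'a::{finite,field}"
  assumes "primitive_element c"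
  shows "x ^ CARD('a) = x"
proof (cases "x = 0")
  case False
  hence "x \<in> UNIV - {0}" by simp
  hence "x \<in> range (\<lambda>n::int. c powi n)"
    using assms by (simp add: primitive_element_def generates_mult_group_def)
  then obtain n where n: "x = c powi n" by blast
  have "has_order c (CARD('a) - 1)"
    using assms primitive_element_iff_has_order primitive_element_nonzero by blast
  hence one: "c ^ (CARD('a) - 1) = 1" by (simp add: has_order_def)
  have "x ^ (CARD('a) - 1) = (c ^ (CARD('a) - 1)) powi n"
    unfolding n by (simp only: power_int_power power_int_power' mult.commute)
  hence "x * x ^ (CARD('a) - 1) = x" using one by simp
  thus ?thesis using CARD_field_ge_2[where 'a = 'a] by (simp flip: power_Suc)
qed (use CARD_field_ge_2[where 'a = 'a] in simp)

lemma eval2_inv_frob: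
  fixes b c :: "'a::{finite,field}"
  assumes "poly (cyclotomic (CARD('a) - 1)) c = 0"
  shows "eval2 (inv_frob F) b c =
    (\<Sum>i\<le>degree F. poly (coeff F (2 * i)) c ^ (CARD('a) div 2) * b ^ i)"
proof -
  define \<Phi> :: "'a poly" where "\<Phi> = cyclotomic (CARD('a) - 1)"
  have root: "poly \<Phi> c = 0" using assms by (simp only: \<Phi>_def)
  have mod: "poly (p mod \<Phi>) c = poly p c" for p
  proof -
    have "poly p c = poly (p div \<Phi> * \<Phi> + p mod \<Phi>) c" by (simp only: div_mult_mod_eq)
    thus ?thesis by (simp only: poly_add poly_mult root mult_zero_right add_0)
  qed
  show ?thesis
    unfolding eval2_def inv_frob_def \<Phi>_def[symmetric]
    by (simp add: poly_sum poly_monom mod poly_const_pow mult.commute)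
qed

text \<open>In characteristic 2 the square of the sum is the sum of the squares. Squaring undoes the
  exponent q/2 on the coefficients and turns \<open>b ^ i\<close> into the power of \<open>b\<close>
  that belongs to index \<open>2 * i\<close>.\<close>

lemma eval2_inv_frob_square:
  fixes b c :: "'a::{finite,field}"
  assumes "CHAR('a) = 2" and "even CARD('a)" and "primitive_element c"
  shows "(eval2 (inv_frob (L \<circ>\<^sub>p [:0, 0, 1:])) b c)\<^sup>2 = eval2 (L \<circ>\<^sub>p [:0, 0, 1:]) b c"
proof -
  define F where "F = L \<circ>\<^sub>p [:0, 0, 1:]"
  note nz = primitive_element_nonzero[OF assms(3)]
  have order: "has_order c (CARD('a) - 1)"
    using assms(3) primitive_element_iff_has_order[OF nz] by blast
  have root: "poly (cyclotomic (CARD('a) - 1)) c = 0"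
    using CARD_field_ge_2[where 'a = 'a] by (intro poly_cyclotomic_root[OF order]) simp
  have sq: "(x ^ (CARD('a) div 2))\<^sup>2 = x" for x :: 'a
    using assms(2) primitive_element_imp_power_card[OF assms(3), of x] by (simp flip: power_mult)
  have bsq: "(b ^ i)\<^sup>2 = (b\<^sup>2) ^ i" for i by (simp add: mult.commute flip: power_mult)
  have deg: "degree F = 2 * degree L" by (simp add: F_def degree_pcompose)
  have "(eval2 (inv_frob F) b c)\<^sup>2 =
      (\<Sum>i\<le>degree F. (poly (coeff F (2 * i)) c ^ (CARD('a) div 2) * b ^ i)\<^sup>2)"
    unfolding eval2_inv_frob[OF root] by (rule freshmans_dream_sum) (simp_all add: assms(1))
  also have "\<dots> = (\<Sum>i\<le>degree F. poly (coeff L i) c * (b\<^sup>2) ^ i)"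
    by (simp add: power_mult_distrib sq bsq F_def coeff_pcompose_square)
  \<comment> \<open>The sum in \<open>inv_frob\<close> runs to the degree of \<open>F\<close>, twice
    that of \<open>L\<close>; the surplus terms are zero.\<close>
  also have "\<dots> = (\<Sum>i\<le>degree L. poly (coeff L i) c * (b\<^sup>2) ^ i)"
    using deg by (intro sum.mono_neutral_right) (auto simp: coeff_eq_0)
  also have "\<dots> = eval2 L (b\<^sup>2) c"
    by (simp add: eval2_def poly_altdef[of L] poly_sum poly_const_pow mult.commute)
  also have "\<dots> = eval2 F b c" by (simp add: F_def eval2_pcompose_square)
  finally show ?thesis by (simp add: F_def)
qed

text \<open>Each member divides \<open>L\<close>, so its zeros are zeros of \<open>L\<close>.
  Conversely \<open>L\<close> divides the product of the members, so a zero of \<open>L\<close> is a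
  zero of some member. Both are applied in the squared variable.\<close>

lemma eval2_inv_frob_monic_lcm:
  fixes b c :: "'a::{finite,field}"
  assumes "CHAR('a) = 2" and "even CARD('a)" and "primitive_element c"
    and "finite I" and "\<And>n. n \<in> I \<Longrightarrow> odd n"
  shows "eval2 (inv_frob (monic_lcm (lucasU ` I))) b c \<noteq> 0 \<longleftrightarrow>
    (\<forall>n\<in>I. eval2 (lucasU n) b c \<noteq> 0)"
proof -
  have "\<forall>n\<in>I. \<exists>u. (lucasU n :: 'a poly poly) = u \<circ>\<^sub>p [:0, 0, 1:] \<and> lead_coeff u dvd 1"
    using odd_lucasU_pcompose_square assms(5) by metis
  then obtain u where u: "\<And>n. n \<in> I \<Longrightarrow> (lucasU n :: 'a poly poly) = u n \<circ>\<^sub>p [:0, 0, 1:]"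
    "\<And>n. n \<in> I \<Longrightarrow> lead_coeff (u n) dvd 1" by metis
  obtain L where L: "monic_lcm ((\<lambda>f. f \<circ>\<^sub>p [:0, 0, 1:]) ` u ` I) = L \<circ>\<^sub>p [:0, 0, 1:]"
    "\<forall>f\<in>u ` I. f dvd L" "L dvd \<Prod>(u ` I)"
    using monic_lcm_pcompose_square[of "u ` I"] assms(4) u(2) by blast
  have "lucasU ` I = (\<lambda>f. f \<circ>\<^sub>p [:0, 0, 1:]) ` u ` I"
    unfolding image_image by (rule image_cong) (use u(1) in auto)
  hence "(eval2 (inv_frob (monic_lcm (lucasU ` I))) b c)\<^sup>2 = eval2 (L \<circ>\<^sub>p [:0, 0, 1:]) b c"
    using eval2_inv_frob_square[OF assms(1-3)] L(1) by simp
  also have "\<dots> = eval2 L (b\<^sup>2) c" by (rule eval2_pcompose_square)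
  finally have E: "eval2 (inv_frob (monic_lcm (lucasU ` I))) b c = 0 \<longleftrightarrow> eval2 L (b\<^sup>2) c = 0"
    by (metis power_zero_numeral zero_eq_power2)
  have "eval2 L (b\<^sup>2) c = 0 \<longleftrightarrow> (\<exists>f\<in>u ` I. eval2 f (b\<^sup>2) c = 0)"
  proof
    assume "eval2 L (b\<^sup>2) c = 0"
    moreover obtain K where "\<Prod>(u ` I) = L * K" using L(3) by (auto simp: dvd_def)
    ultimately have "eval2 (\<Prod>(u ` I)) (b\<^sup>2) c = 0" by simp
    thus "\<exists>f\<in>u ` I. eval2 f (b\<^sup>2) c = 0" using assms(4) by (simp add: eval2_prod)
  next
    assume "\<exists>f\<in>u ` I. eval2 f (b\<^sup>2) c = 0"
    then obtain f where "f \<in> u ` I" "eval2 f (b\<^sup>2) c = 0" by blast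
    moreover from this obtain K where "L = f * K" using L(2) by (metis dvdE)
    ultimately show "eval2 L (b\<^sup>2) c = 0" by simp
  qed
  also have "\<dots> \<longleftrightarrow> (\<exists>n\<in>I. eval2 (lucasU n) b c = 0)"
    using u(1) by (simp add: eval2_pcompose_square)
  finally show ?thesis using E by blast
qed

lemma CHAR_eq_2:
  assumes "CARD('a::{finite,field}) = 2 ^ k"
  shows "CHAR('a) = 2"
proof -
  have "CHAR('a) > 0" by (rule finite_imp_CHAR_pos) simp
  hence "prime CHAR('a)" by (rule prime_CHAR_semidom)
  moreover have "CHAR('a) dvd 2 ^ k" using CHAR_dvd_CARD[where 'a = 'a] assms by simp
  ultimately show ?thesis by (metis prime_dvd_power primes_dvd_imp_eq two_is_prime_nat)
qed

section \<open>Roots of an irreducible quadratic\<close>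

lemma irreducible_quadratic_no_root:
  fixes b c :: "'a::field"
  assumes "irreducible [:c, b, 1:]"
  shows "poly [:c, b, 1:] x \<noteq> 0"
proof
  assume "poly [:c, b, 1:] x = 0"
  then obtain g where g: "[:c, b, 1:] = [:- x, 1:] * g"
    by (metis poly_eq_0_iff_dvd dvdE)
  hence "g \<noteq> 0" by auto
  hence "degree [:c, b, 1:] = degree [:- x, 1:] + degree g"
    unfolding g by (intro degree_mult_eq) auto
  hence "degree g = 1" by simp
  moreover have "[:- x, 1:] dvd 1 \<or> g dvd 1" using irreducibleD[OF assms g] .
  ultimately show False by (auto simp: is_unit_iff_degree \<open>g \<noteq> 0\<close>)
qed

text \<open>The base field already supplies q zeros of X^q - X, which has no more. Hence an element
  of the closure outside the base field is moved by the q-th power map.\<close>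

lemma range_to_ac_eq:
  assumes "\<And>x::'a::{finite,field}. x ^ CARD('a) = x"
  shows "range to_ac = {y::'a alg_closure. y ^ CARD('a) = y}"
proof -
  define P where "P = (monom 1 CARD('a) - monom 1 1 :: 'a alg_closure poly)"
  have roots: "{y. poly P y = 0} = {y. y ^ CARD('a) = y}" by (simp add: P_def poly_monom)
  have "coeff P CARD('a) = 1" using CARD_field_ge_2[where 'a = 'a] by (simp add: P_def)
  hence "P \<noteq> 0" by auto
  have "degree P \<le> CARD('a)"
    unfolding P_def by (rule degree_diff_le) (simp_all add: degree_monom_eq)
  hence "card {y::'a alg_closure. y ^ CARD('a) = y} \<le> CARD('a)"
    using card_poly_roots_bound[OF \<open>P \<noteq> 0\<close>] roots by simp
  also have "\<dots> = card (range (to_ac :: 'a \<Rightarrow> _))" by (simp add: card_image inj_to_ac)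
  finally show ?thesis
    using poly_roots_finite[OF \<open>P \<noteq> 0\<close>] roots assms
    by (intro card_seteq) (auto simp flip: to_ac_power)
qed

lemma finite_quadratic_extension:
  "finite (quadratic_extension :: 'a::{finite,field} alg_closure set)"
  and card_quadratic_extension_le:
  "card (quadratic_extension :: 'a alg_closure set) \<le> CARD('a)\<^sup>2"
proof -
  define P where "P = (monom 1 (CARD('a)\<^sup>2) - monom 1 1 :: 'a alg_closure poly)"
  have roots: "{y. poly P y = 0} = quadratic_extension"
    by (simp add: P_def poly_monom quadratic_extension_def)
  \<comment> \<open>The exponent exceeds 1, so the subtracted linear monomial leaves the top
    coefficient alone.\<close>
  have "2\<^sup>2 \<le> CARD('a)\<^sup>2" using CARD_field_ge_2[where 'a = 'a] by (rule power_mono) simp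
  hence "coeff P (CARD('a)\<^sup>2) = 1" by (simp add: P_def)
  hence "P \<noteq> 0" by auto
  have "degree P \<le> CARD('a)\<^sup>2"
    unfolding P_def by (rule degree_diff_le) (simp_all add: degree_monom_eq)
  thus "finite (quadratic_extension :: 'a alg_closure set)"
    and "card (quadratic_extension :: 'a alg_closure set) \<le> CARD('a)\<^sup>2"
    using card_poly_roots_bound[OF \<open>P \<noteq> 0\<close>] poly_roots_finite[OF \<open>P \<noteq> 0\<close>] roots by simp_all
qed

text \<open>The q-th power map is additive and fixes the coefficients, so it sends the root \<alpha>
  to a root \<beta>. They differ because \<alpha> lies outside the base field, and the relations of
  Vieta follow.\<close>

lemma quadratic_conjugates:
  fixes b c :: "'a::{finite,field}" and \<alpha> :: "'a alg_closure"
  assumes card: "CARD('a) = CHAR('a) ^ k" and fixed: "\<And>x::'a. x ^ CARD('a) = x"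
    and irr: "irreducible [:c, b, 1:]"
    and root: "poly (map_poly to_ac [:c, b, 1:]) \<alpha> = 0"
  defines "\<beta> \<equiv> \<alpha> ^ CARD('a)"
  shows "\<alpha> \<notin> range to_ac" and "\<alpha> \<noteq> \<beta>" and "\<alpha> + \<beta> = - to_ac b" and "\<alpha> * \<beta> = to_ac c"
    and "\<alpha> \<in> quadratic_extension"
proof -
  have frob: "(x + y) ^ CARD('a) = x ^ CARD('a) + y ^ CARD('a)" for x y :: "'a alg_closure"
  proof (rule freshmans_dream')
    have "CHAR('a) > 0" by (rule finite_imp_CHAR_pos) simp
    thus "prime CHAR('a alg_closure)" using prime_CHAR_semidom by simp
  qed (simp add: card)
  have eq\<alpha>: "\<alpha>\<^sup>2 + to_ac b * \<alpha> + to_ac c = 0"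
    using root by (simp add: power2_eq_square algebra_simps)
  hence "(\<alpha>\<^sup>2 + to_ac b * \<alpha> + to_ac c) ^ CARD('a) = 0"
    using CARD_field_ge_2[where 'a = 'a] by simp
  hence eq\<beta>: "\<beta>\<^sup>2 + to_ac b * \<beta> + to_ac c = 0"
    by (simp add: frob power_mult_distrib \<beta>_def fixed flip: to_ac_power power_mult)
       (simp add: mult.commute)
  show notin: "\<alpha> \<notin> range to_ac"
  proof
    assume "\<alpha> \<in> range to_ac"
    then obtain x where "\<alpha> = to_ac x" by blast
    hence "to_ac (x\<^sup>2 + b * x + c) = 0" using eq\<alpha> by simp
    hence "x\<^sup>2 + b * x + c = 0" by (simp only: to_ac_eq_0_iff)
    hence "poly [:c, b, 1:] x = 0" by (simp add: power2_eq_square algebra_simps)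
    thus False using irreducible_quadratic_no_root[OF irr] by blast
  qed
  thus ne: "\<alpha> \<noteq> \<beta>" unfolding range_to_ac_eq[OF fixed] \<beta>_def by auto
  \<comment> \<open>Subtracting the two quadratic equations leaves the factor \<alpha> - \<beta>,
    which can be cancelled.\<close>
  have "(\<alpha> - \<beta>) * (\<alpha> + \<beta> + to_ac b) =
      (\<alpha>\<^sup>2 + to_ac b * \<alpha> + to_ac c) - (\<beta>\<^sup>2 + to_ac b * \<beta> + to_ac c)"
    by (simp add: power2_eq_square algebra_simps)
  hence "\<alpha> + \<beta> + to_ac b = 0" using eq\<alpha> eq\<beta> ne by simp
  thus sum: "\<alpha> + \<beta> = - to_ac b" by (simp add: eq_neg_iff_add_eq_0)
  have "to_ac c = - \<alpha>\<^sup>2 - to_ac b * \<alpha>" using eq\<alpha> by (simp add: algebra_simps eq_neg_iff_add_eq_0)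
  also have "to_ac b = - (\<alpha> + \<beta>)" using sum by simp
  finally show prod: "\<alpha> * \<beta> = to_ac c" by (simp add: power2_eq_square algebra_simps)
  \<comment> \<open>The sum of the roots lies in the base field and is fixed by the q-th power map,
    so \<beta> is sent back to \<alpha>.\<close>
  have "\<beta> + \<beta> ^ CARD('a) = (\<alpha> + \<beta>) ^ CARD('a)" by (simp add: frob \<beta>_def)
  also have "\<dots> = to_ac ((- b) ^ CARD('a))" by (simp only: sum to_ac_power to_ac_minus)
  also have "\<dots> = \<alpha> + \<beta>" by (simp only: fixed sum to_ac_minus)
  finally have "\<beta> ^ CARD('a) = \<alpha>" by simp
  thus "\<alpha> \<in> quadratic_extension"
    by (simp add: quadratic_extension_def \<beta>_def power2_eq_square flip: power_mult)
qed

text \<open>The elements \<open>x + y \<alpha>\<close> with \<open>x, y\<close> in the base field exhaust the quadratic extension.\<close>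

lemma card_quadratic_extension:
  fixes \<alpha> :: "'a::{finite,field} alg_closure"
  assumes card: "CARD('a) = CHAR('a) ^ k" and fixed: "\<And>x::'a. x ^ CARD('a) = x"
    and \<alpha>: "\<alpha> \<in> quadratic_extension" "\<alpha> \<notin> range to_ac"
  shows "card (quadratic_extension :: 'a alg_closure set) = CARD('a)\<^sup>2"
proof (rule antisym[OF card_quadratic_extension_le])
  define h where "h = (\<lambda>(x, y). to_ac x + to_ac y * \<alpha>)"
  have "inj h"
  proof (rule injI, clarify)
    fix x y x' y' assume eq: "h (x, y) = h (x', y')"
    show "x = x' \<and> y = y'"
    proof (cases "y = y'")
      case True
      with eq show ?thesis by (simp add: h_def)
    next
      case False
      \<comment> \<open>Two representations with different \<open>y\<close> would express \<alpha>
        as a quotient of base field elements.\<close>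
      have "to_ac (y - y') * \<alpha> = to_ac (x' - x)" using eq by (simp add: h_def algebra_simps)
      hence "\<alpha> = to_ac ((x' - x) / (y - y'))" using False by (simp add: field_simps)
      thus ?thesis using \<alpha>(2) by blast
    qed
  qed
  hence "CARD('a)\<^sup>2 = card (range h)"
    by (simp add: card_image card_cartesian_product power2_eq_square flip: UNIV_Times_UNIV)
  also have "\<dots> \<le> card (quadratic_extension :: 'a alg_closure set)"
  proof (rule card_mono[OF finite_quadratic_extension], clarify)
    fix x y
    have "(u + v) ^ (CARD('a)\<^sup>2) = u ^ (CARD('a)\<^sup>2) + v ^ (CARD('a)\<^sup>2)" for u v :: "'a alg_closure"
    proof (rule freshmans_dream'[where n = "k * 2"])
      have "CHAR('a) > 0" by (rule finite_imp_CHAR_pos) simp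
      thus "prime CHAR('a alg_closure)" using prime_CHAR_semidom by simp
    qed (simp add: card power_mult)
    moreover have "z ^ (CARD('a)\<^sup>2) = z" for z :: 'a
      by (simp add: power2_eq_square power_mult fixed)
    ultimately show "h (x, y) \<in> quadratic_extension"
      using \<alpha>(1) by (simp add: h_def quadratic_extension_def power_mult_distrib flip: to_ac_power)
  qed
  finally show "CARD('a)\<^sup>2 \<le> card (quadratic_extension :: 'a alg_closure set)" .
qed

text \<open>The Binet formula with denominators cleared: by the relations of Vieta, \<alpha>^n -
  \<beta>^n satisfies the same recurrence.\<close>

lemma lucasU_binet:
  fixes \<alpha> \<beta> :: "'a::field alg_closure"
  assumes "\<alpha> + \<beta> = - to_ac b" and "\<alpha> * \<beta> = to_ac c"
  shows "to_ac (eval2 (lucasU n) b c) * (\<alpha> - \<beta>) = \<alpha> ^ n - \<beta> ^ n"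
proof (induction n rule: lucasU.induct)
  case (3 n)
  have b: "- to_ac b = \<alpha> + \<beta>" using assms(1) by simp
  have "eval2 (lucasU (Suc (Suc n))) b c =
      - b * eval2 (lucasU (Suc n)) b c - c * eval2 (lucasU n) b c"
    by (simp only: lucasU.simps eval2_simps)
  hence "to_ac (eval2 (lucasU (Suc (Suc n))) b c) * (\<alpha> - \<beta>) =
    (- to_ac b) * (to_ac (eval2 (lucasU (Suc n)) b c) * (\<alpha> - \<beta>)) -
    to_ac c * (to_ac (eval2 (lucasU n) b c) * (\<alpha> - \<beta>))"
    by (simp only: to_ac_diff to_ac_mult to_ac_minus left_diff_distrib mult.assoc)
  also have "\<dots> = (\<alpha> + \<beta>) * (\<alpha> ^ Suc n - \<beta> ^ Suc n) - \<alpha> * \<beta> * (\<alpha> ^ n - \<beta> ^ n)"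
    unfolding "3.IH" b assms(2)[symmetric] ..
  also have "\<dots> = \<alpha> ^ Suc (Suc n) - \<beta> ^ Suc (Suc n)" by (simp add: algebra_simps)
  finally show ?case .
qed auto

lemma generates_iff_lucasU_nonzero:
  fixes b c :: "'a::{finite,field}" and \<alpha> :: "'a alg_closure"
  assumes card: "CARD('a) = CHAR('a) ^ k" and prim: "primitive_element c"
    and irr: "irreducible [:c, b, 1:]"
    and root: "poly (map_poly to_ac [:c, b, 1:]) \<alpha> = 0"
  shows "generates_mult_group quadratic_extension \<alpha> \<longleftrightarrow>
    (\<forall>p. prime p \<and> p dvd CARD('a) + 1 \<longrightarrow> eval2 (lucasU ((CARD('a) + 1) div p)) b c \<noteq> 0)"
proof -
  define q where "q = CARD('a)"
  have q: "q \<ge> 2" using CARD_field_ge_2[where 'a = 'a] by (simp add: q_def)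
  note fixed = primitive_element_imp_power_card[OF prim]
  note conj = quadratic_conjugates[OF card fixed irr root, folded q_def]
  have nz: "\<alpha> \<noteq> 0" using conj(1) by (metis rangeI to_ac_0)
  have pow: "\<alpha> ^ (q\<^sup>2) = \<alpha>" using conj(5) by (simp add: quadratic_extension_def q_def)
  have q2: "q\<^sup>2 - 1 = (q - 1) * (q + 1)" using q by (simp add: power2_eq_square algebra_simps)
  have pos: "q\<^sup>2 - 1 > 0" unfolding q2 using q by simp
  have card0: "card (quadratic_extension - {0 :: 'a alg_closure}) = q\<^sup>2 - 1"
    using card_quadratic_extension[OF card fixed conj(5,1)] q
    by (subst card_Diff_singleton) (auto simp: quadratic_extension_def q_def)
  have "range (\<lambda>n::int. \<alpha> powi n) \<subseteq> quadratic_extension - {0}"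
  proof clarify
    fix n :: int
    have "(\<alpha> powi n) ^ q\<^sup>2 = (\<alpha> ^ q\<^sup>2) powi n"
      by (simp only: power_int_power power_int_power' mult.commute)
    thus "\<alpha> powi n \<in> quadratic_extension - {0}"
      using nz by (simp add: pow quadratic_extension_def flip: q_def)
  qed
  moreover have "quadratic_extension - {0 :: 'a alg_closure} \<noteq> {}" using card0 pos by (metis card.empty less_irrefl)
  ultimately have gen: "generates_mult_group quadratic_extension \<alpha> \<longleftrightarrow> has_order \<alpha> (q\<^sup>2 - 1)"
    using generates_mult_group_iff[OF finite_quadratic_extension] card0 by metis
  have lucas: "eval2 (lucasU n) b c = 0 \<longleftrightarrow> \<alpha> ^ ((q - 1) * n) = 1" for n
  proof -
    have "eval2 (lucasU n) b c = 0 \<longleftrightarrow> \<alpha> ^ n = (\<alpha> ^ q) ^ n"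
      using lucasU_binet[OF conj(3,4), of n] conj(2) by auto
    \<comment> \<open>Splitting q n as n + (q - 1) n lets the nonzero factor \<alpha>^n be
      cancelled.\<close>
    also have "(\<alpha> ^ q) ^ n = \<alpha> ^ (n + (q - 1) * n)"
      using q by (simp add: algebra_simps flip: power_mult)
    also have "\<alpha> ^ n = \<alpha> ^ (n + (q - 1) * n) \<longleftrightarrow> \<alpha> ^ ((q - 1) * n) = 1"
      using nz by (simp add: power_add)
    finally show ?thesis .
  qed
  have "has_order \<alpha> (q\<^sup>2 - 1) \<longleftrightarrow>
      (\<forall>p. prime p \<and> p dvd q + 1 \<longrightarrow> \<alpha> ^ ((q - 1) * ((q + 1) div p)) \<noteq> 1)"
  proof (intro iffI allI impI)
    fix p assume order: "has_order \<alpha> (q\<^sup>2 - 1)" and p: "prime p \<and> p dvd q + 1"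
    have "p > 1" using p prime_gt_1_nat by blast
    hence "(q + 1) div p < q + 1" "(q + 1) div p > 0"
      using p by (auto simp: div_greater_zero_iff dvd_imp_le)
    \<comment> \<open>A positive exponent below the order cannot be a multiple of it.\<close>
    hence "(q - 1) * ((q + 1) div p) < q\<^sup>2 - 1" "(q - 1) * ((q + 1) div p) > 0"
      unfolding q2 using q by (auto simp del: mult_Suc mult_Suc_right add_Suc_right Suc_eq_plus1)
    thus "\<alpha> ^ ((q - 1) * ((q + 1) div p)) \<noteq> 1"
      using order by (auto simp: has_order_def dest: dvd_imp_le)
  next
    assume ne: "\<forall>p. prime p \<and> p dvd q + 1 \<longrightarrow> \<alpha> ^ ((q - 1) * ((q + 1) div p)) \<noteq> 1"
    show "has_order \<alpha> (q\<^sup>2 - 1)"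
    proof (rule has_orderI_prime[OF _ pos])
      have "Suc (q\<^sup>2 - 1) = q\<^sup>2" using pos by simp
      hence "\<alpha> * \<alpha> ^ (q\<^sup>2 - 1) = \<alpha> * 1" using pow by (metis power_Suc mult.right_neutral)
      thus "\<alpha> ^ (q\<^sup>2 - 1) = 1" using nz by (simp only: mult_cancel_left simp_thms)
    next
      fix p :: nat assume p: "prime p" "p dvd q\<^sup>2 - 1"
      hence "p dvd q - 1 \<or> p dvd q + 1" unfolding q2 by (simp only: prime_dvd_mult_iff)
      thus "\<alpha> ^ ((q\<^sup>2 - 1) div p) \<noteq> 1"
      proof
        assume "p dvd q + 1"
        moreover from this have "(q\<^sup>2 - 1) div p = (q - 1) * ((q + 1) div p)"
          unfolding q2 by (rule div_mult_swap[symmetric])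
        ultimately show ?thesis using ne p by simp
      next
        assume dvd: "p dvd q - 1"
        \<comment> \<open>The factor q + 1 is taken out because \<alpha>^(q+1) is the product of the
          conjugates, that is \<open>c\<close>. What remains is a proper power of \<open>c\<close>,
          which has order q - 1.\<close>
        hence "(q\<^sup>2 - 1) div p = (q + 1) * ((q - 1) div p)"
          unfolding q2 by (simp add: div_mult_swap mult.commute)
        hence "\<alpha> ^ ((q\<^sup>2 - 1) div p) = (\<alpha> ^ Suc q) ^ ((q - 1) div p)"
          by (simp only: power_mult Suc_eq_plus1)
        hence "\<alpha> ^ ((q\<^sup>2 - 1) div p) = (\<alpha> * \<alpha> ^ q) ^ ((q - 1) div p)"
          by (simp only: power_Suc)
        also have "\<dots> = to_ac (c ^ ((q - 1) div p))" using conj(4) by simp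
        finally have eq: "\<alpha> ^ ((q\<^sup>2 - 1) div p) = to_ac (c ^ ((q - 1) div p))" .
        have "has_order c (q - 1)"
          using prim primitive_element_iff_has_order primitive_element_nonzero q_def by blast
        moreover have "(q - 1) div p < q - 1" "(q - 1) div p > 0"
          using q dvd p(1) prime_gt_1_nat[OF p(1)] by (auto simp: div_greater_zero_iff dvd_imp_le)
        ultimately have "c ^ ((q - 1) div p) \<noteq> 1" by (auto simp: has_order_def dest: dvd_imp_le)
        thus ?thesis unfolding eq by (metis to_ac_1 to_ac_eq_iff)
      qed
    qed
  qed
  thus ?thesis unfolding gen q_def[symmetric] lucas .
qed

text \<open>A nonzero polynomial of degree at most 1 vanishing at \<alpha> would place \<alpha> in
  the base field and give the quadratic a root there.\<close>

lemma is_minimal_poly_irreducible_quadratic: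
  fixes b c :: "'a::field"
  assumes irr: "irreducible [:c, b, 1:]" and root: "poly (map_poly to_ac [:c, b, 1:]) \<alpha> = 0"
  shows "is_minimal_poly [:c, b, 1:] \<alpha>"
proof -
  have "degree g \<ge> 2" if g: "g \<noteq> 0" "poly (map_poly to_ac g) \<alpha> = 0" for g :: "'a poly"
  proof (rule ccontr)
    assume "\<not> degree g \<ge> 2"
    hence "g = [:coeff g 0, coeff g 1:]"
      by (intro poly_eqI) (auto simp: coeff_pCons coeff_eq_0 split: nat.splits)
    then obtain d e where de: "g = [:d, e:]" by blast
    hence eq: "to_ac d + \<alpha> * to_ac e = 0"
      using g(2) by (cases "d = 0"; cases "e = 0") simp_all
    \<comment> \<open>With \<open>e = 0\<close> the equation would force \<open>d = 0\<close> and
      hence \<open>g = 0\<close>.\<close>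
    have "e \<noteq> 0" using g(1) de eq by auto
    have "\<alpha> * to_ac e = - to_ac d" using eq by (metis add.commute eq_neg_iff_add_eq_0)
    hence "\<alpha> = - to_ac d / to_ac e"
      using \<open>e \<noteq> 0\<close> by (metis nonzero_mult_div_cancel_right to_ac_eq_0_iff)
    hence "\<alpha> = to_ac (- d / e)" by simp
    moreover have "poly (map_poly to_ac [:c, b, 1:]) (to_ac x) = to_ac (poly [:c, b, 1:] x)" for x
      by simp
    ultimately have "to_ac (poly [:c, b, 1:] (- d / e)) = 0" using root by (simp only:)
    thus False using irreducible_quadratic_no_root[OF irr] by (simp only: to_ac_eq_0_iff)
  qed
  moreover have "degree [:c, b, 1:] = 2" "lead_coeff [:c, b, 1:] = 1" by simp_all
  ultimately show ?thesis using root by (metis is_minimal_poly_def)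
qed

theorem proposition5p13:
  fixes b c :: "'a::{finite,field}"
    and q k N s :: nat
    and p e :: "nat \<Rightarrow> nat"
    and E :: "'a poly poly"
  assumes "CARD('a) = q" and "q = 2 ^ k"
    and "N = q + 1" and "N = (\<Prod>i=1..s. p i ^ e i)"
    and "inj_on p {1..s}"
    and "\<And>i. i \<in> {1..s} \<Longrightarrow> prime (p i) \<and> odd (p i)"
    and "\<And>i. i \<in> {1..s} \<Longrightarrow> e i > 0"
    and "E = inv_frob (monic_lcm ((\<lambda>i. lucasU (N div p i)) ` {1..s}))"
    and "irreducible [:c, b, 1:]"
    and "primitive_element c"
  shows "primitive_quadratic [:c, b, 1:] \<longleftrightarrow> eval2 E b c \<noteq> 0"
proof -
  define I where "I = (\<lambda>i. N div p i) ` {1..s}"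
  have char: "CHAR('a) = 2" using CHAR_eq_2 assms(1,2) by metis
  have card: "CARD('a) = CHAR('a) ^ k" using char assms(1,2) by simp
  \<comment> \<open>A field has at least two elements, which excludes \<open>k = 0\<close>.\<close>
  have even: "even CARD('a)"
    using CARD_field_ge_2[where 'a = 'a] assms(1,2) by (cases k) auto
  have dvd: "p i dvd N" if "i \<in> {1..s}" for i
  proof -
    have "p i dvd p i ^ e i" using assms(7)[OF that] by (simp add: dvd_power)
    also have "p i ^ e i dvd N" unfolding assms(4) using that by (intro dvd_prodI) auto
    finally show ?thesis .
  qed
  \<comment> \<open>The conditions indexed by 1 to \<open>s\<close> thus become conditions at all
    prime divisors of \<open>N\<close>, as the order criterion demands.\<close>
  have primes: "prime r \<and> r dvd N \<longleftrightarrow> r \<in> p ` {1..s}" for r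
  proof
    assume r: "prime r \<and> r dvd N"
    hence "r dvd (\<Prod>i=1..s. p i ^ e i)" using assms(4) by (simp only:)
    hence "\<exists>i\<in>{1..s}. r dvd p i ^ e i"
      using r by (subst (asm) prime_dvd_prod_iff) simp_all
    then obtain i where i: "i \<in> {1..s}" "r dvd p i ^ e i" by blast
    hence "r dvd p i" using r prime_dvd_power by blast
    hence "r = p i" using r assms(6)[OF i(1)] primes_dvd_imp_eq by blast
    thus "r \<in> p ` {1..s}" using i(1) by blast
  qed (use assms(6) dvd in auto)
  \<comment> \<open>\<open>N\<close> is odd because q is even, so its divisors are odd; this places
    the Lucas polynomials concerned among the polynomials in B^2.\<close>
  have odd: "odd n" if n: "n \<in> I" for n
  proof -
    obtain i where i: "i \<in> {1..s}" "n = N div p i" using n I_def by blast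
    hence "N = n * p i" using dvd by simp
    thus ?thesis using even assms(1,3) by (metis even_mult_iff odd_one even_add)
  qed
  have "E = inv_frob (monic_lcm (lucasU ` I))"
    unfolding assms(8) I_def image_image ..
  hence "eval2 E b c \<noteq> 0 \<longleftrightarrow> (\<forall>n\<in>I. eval2 (lucasU n) b c \<noteq> 0)"
    using eval2_inv_frob_monic_lcm[OF char even assms(10), of I] odd by (simp add: I_def)
  also have "\<dots> \<longleftrightarrow> (\<forall>r\<in>p ` {1..s}. eval2 (lucasU (N div r)) b c \<noteq> 0)"
    unfolding I_def by simp
  also have "\<dots> \<longleftrightarrow> (\<forall>r. prime r \<and> r dvd N \<longrightarrow> eval2 (lucasU (N div r)) b c \<noteq> 0)"
    unfolding primes by blast
  finally have E: "eval2 E b c \<noteq> 0 \<longleftrightarrow>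
    (\<forall>r. prime r \<and> r dvd N \<longrightarrow> eval2 (lucasU (N div r)) b c \<noteq> 0)" .
  \<comment> \<open>Stated for an arbitrary root, since it is applied both to the generator supplied
    by primitivity and to a root chosen in the algebraic closure.\<close>
  have gen: "generates_mult_group quadratic_extension \<alpha> \<longleftrightarrow> eval2 E b c \<noteq> 0"
    if "poly (map_poly to_ac [:c, b, 1:]) \<alpha> = 0" for \<alpha>
    using generates_iff_lucasU_nonzero[OF card assms(10,9) that] E assms(1,3) by simp
  have "degree (map_poly to_ac [:c, b, 1:] :: 'a alg_closure poly) = 2"
    by simp
  then obtain \<alpha> :: "'a alg_closure" where \<alpha>: "poly (map_poly to_ac [:c, b, 1:]) \<alpha> = 0"
    using alg_closed_imp_poly_has_root by (metis zero_less_numeral)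
  show ?thesis
  proof
    assume "primitive_quadratic [:c, b, 1:]"
    then obtain \<gamma> where "generates_mult_group quadratic_extension \<gamma>" "is_minimal_poly [:c, b, 1:] \<gamma>"
      by (auto simp: primitive_quadratic_def)
    thus "eval2 E b c \<noteq> 0" using gen by (auto simp: is_minimal_poly_def)
  next
    assume "eval2 E b c \<noteq> 0"
    hence "generates_mult_group quadratic_extension \<alpha>" using gen \<alpha> by blast
    moreover have "is_minimal_poly [:c, b, 1:] \<alpha>"
      by (rule is_minimal_poly_irreducible_quadratic[OF assms(9) \<alpha>])
    ultimately show "primitive_quadratic [:c, b, 1:]"
      by (auto simp: primitive_quadratic_def)
  qed
qed

end
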